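(* Let $\phi:[0,\infty)\to[0,\infty)$ be an increasing convex function such that the measure $\mu(A)=\int_A e^{-\phi(|x|)}\,dx$ on $\mathbb{R}^n$ is a probability measure (a rotation invariant log-concave probability measure with non-constant density). Let $K\subset\mathbb{R}^n$ be a convex symmetric body and let $r(K,B_2^n)=\max\{R>0:RB_2^n\subset K\}$. Then $$\limsup_{t\to\infty}\frac{\ln\mu\big((tK)^c\big)}{\phi(r(K,B_2^n)\,t)}=-1.$$
   Context: $|x|$ is the Euclidean norm on $\mathbb{R}^n$ and $B_2^n$ is the closed Euclidean unit ball. A convex body is a convex compact set with nonempty interior; it is symmetric if $K=-K$. For $t>0$, $tA=\{ta:a\in A\}$, and $A^c=\mathbb{R}^n\setminus A$. "Increasing" is understood as non-decreasing (the function $\phi$ may be constant on an initial interval $[0,t_0]$, but it is not constant on $[0,\infty)$). *)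

theory Defs
  imports "HOL-Probability.Probability"
begin

definition convex_body :: "'a::euclidean_space set \<Rightarrow> bool" where
  "convex_body K \<longleftrightarrow> convex K \<and> compact K \<and> interior K \<noteq> {}"

definition symmetric_set :: "'a::real_vector set \<Rightarrow> bool" where
  "symmetric_set K \<longleftrightarrow> K = uminus ` K"

(* The maximum r(K, L); the GREATEST operator returns it only when it is attained,
   which relative_inradius_max shows for symmetric convex bodies K and the unit ball L. *)
definition relative_inradius :: "'a::real_vector set \<Rightarrow> 'a set \<Rightarrow> real" where
  "relative_inradius K L = (GREATEST R. R > 0 \<and> (*\<^sub>R) R ` L \<subseteq> K)"

(* Only the values of \<phi> on [0, \<infinity>) matter. *)
definition radial_measure :: "(real \<Rightarrow> real) \<Rightarrow> 'a::euclidean_space measure" where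
  "radial_measure \<phi> = density lborel (\<lambda>x. ennreal (exp (- \<phi> (norm x))))"

lemma scaleR_unit_cball:
  fixes R :: real
  assumes "R > 0"
  shows "(*\<^sub>R) R ` cball (0::'a::euclidean_space) 1 = cball 0 R"
  using cball_scale[of R "0::'a" 1] assms by simp

lemma relative_inradius_max:
  fixes K :: "'a::euclidean_space set"
  assumes "convex_body K" "symmetric_set K"
  shows "relative_inradius K (cball 0 1) > 0"
    and "(*\<^sub>R) (relative_inradius K (cball 0 1)) ` cball 0 1 \<subseteq> K"
    and "\<And>R. R > 0 \<Longrightarrow> (*\<^sub>R) R ` cball 0 1 \<subseteq> K \<Longrightarrow> R \<le> relative_inradius K (cball 0 1)"
proof -
  have K: "convex K" "compact K" "interior K \<noteq> {}" and sym: "K = uminus ` K"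
    using assms by (auto simp: convex_body_def symmetric_set_def)
  obtain x e where e: "e > 0" "ball x e \<subseteq> K"
    using K(3) by (auto simp: mem_interior)
  have "cball 0 (e/2) \<subseteq> K"
  proof
    fix z :: 'a assume "z \<in> cball 0 (e/2)"
    then have nz: "norm z < e" using e by simp
    have "x + z \<in> K" "x - z \<in> K"
      using nz e(2) by (auto simp: dist_norm subset_iff)
    moreover have "- (x - z) \<in> K" using \<open>x - z \<in> K\<close> sym by blast
    ultimately have "(1/2) *\<^sub>R (x + z) + (1/2) *\<^sub>R (- (x - z)) \<in> K"
      using K(1) by (intro convexD) auto
    moreover have "(1/2) *\<^sub>R (x + z) + (1/2) *\<^sub>R (- (x - z)) = z"
      by (simp add: algebra_simps flip: scaleR_add_left)
    ultimately show "z \<in> K" by simp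
  qed
  then have e2: "e/2 \<in> {R. R > 0 \<and> cball 0 R \<subseteq> K}" using e by simp
  let ?S = "{R. R > 0 \<and> cball 0 R \<subseteq> K}"
  obtain b where b: "\<And>y. y \<in> K \<Longrightarrow> norm y \<le> b"
    using compact_imp_bounded[OF K(2)] by (auto simp: bounded_iff)
  have ub: "R \<le> b" if "R \<in> ?S" for R
  proof -
    have "0 \<le> R" using that by simp
    then obtain u :: 'a where "norm u = R"
      by (rule vector_choose_size)
    then show ?thesis using b[of u] that by auto
  qed
  have bdd: "bdd_above ?S" by (rule bdd_aboveI[OF ub])
  define r where "r = Sup ?S"
  have le: "R \<le> r" if "R \<in> ?S" for R
    unfolding r_def by (rule cSup_upper[OF that bdd])
  have rpos: "r > 0" using le[OF e2] e by simp
  have "ball 0 r \<subseteq> K"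
  proof
    fix z :: 'a assume "z \<in> ball 0 r"
    then have "norm z < Sup ?S" by (simp add: r_def)
    then obtain R where "R \<in> ?S" "norm z < R"
      using less_cSup_iff[of ?S "norm z"] e2 bdd by blast
    then show "z \<in> K" by auto
  qed
  then have "closure (ball 0 r) \<subseteq> K"
    using K(2) by (simp add: closure_minimal compact_imp_closed)
  then have cb: "cball 0 r \<subseteq> K" using rpos by simp
  have eq: "relative_inradius K (cball 0 1) = r"
    unfolding relative_inradius_def
    by (rule Greatest_equality) (use rpos cb le in \<open>auto simp: scaleR_unit_cball\<close>)
  show "relative_inradius K (cball 0 1) > 0"
    and "(*\<^sub>R) (relative_inradius K (cball 0 1)) ` cball 0 1 \<subseteq> K"
    using rpos cb by (simp_all add: eq scaleR_unit_cball)
  show "R \<le> relative_inradius K (cball 0 1)" if "R > 0" "(*\<^sub>R) R ` cball 0 1 \<subseteq> K" for R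
    using le[of R] that by (simp add: eq scaleR_unit_cball)
qed

end

theory Submission
  imports Defs
begin

text \<open>
  Write \<open>r\<close> for the inradius. For the upper bound, \<open>t K\<close> contains the ball of radius
  \<open>s = r t\<close>, and on its complement \<open>\<phi>(|x|) \<ge> (1 - e) \<phi>(s) + e \<phi>(|x|)\<close>, so the mass is at most
  \<open>C exp (- (1 - e) \<phi>(s))\<close> with \<open>C = \<integral> exp (- e \<phi>(|x|)) dx\<close>; this is finite because convexity
  gives \<open>e \<phi>(|x|) \<ge> \<phi>(e |x|) - (1 - e) \<phi>(0)\<close>.

  For the lower bound, \<open>K\<close> lies in a half-space \<open>x \<bullet> u \<le> r\<close>, so the complement of \<open>t K\<close>
  contains a ball of diameter \<open>d\<close> inside the ball of radius \<open>s + d\<close> and has mass at least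
  \<open>c d\<^sup>n exp (- \<phi>(s + d))\<close>. If the limit superior were below \<open>- 1\<close>, this would force
  \<open>\<phi>(s + d) \<ge> (1 + e) \<phi>(s) + ln (c d\<^sup>n)\<close> for all large \<open>s\<close>; iterating with \<open>d = 2\<^sup>-\<^sup>k\<close>
  makes \<open>\<phi>\<close> unbounded on a bounded interval.
\<close>

section \<open>Growth of the radial profile\<close>

text \<open>If \<phi> exceeds \<phi>(0) at some \<open>a\<close>, then for x \<ge> a convexity puts
  \<phi>(a) below the chord over [0, x], so \<phi>(x) lies above the line through the points of the
  graph at 0 and \<open>a\<close>, whose slope is positive.\<close>

lemma convex_mono_at_top:
  fixes \<phi> :: "real \<Rightarrow> real"
  assumes mono: "mono_on {0..} \<phi>" and conv: "convex_on {0..} \<phi>"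
    and nc: "\<not> \<phi> constant_on {0..}"
  shows "filterlim \<phi> at_top at_top"
proof -
  obtain a where a: "a > 0" "\<phi> 0 < \<phi> a"
  proof -
    have "\<exists>a\<ge>0. \<phi> a \<noteq> \<phi> 0"
      using nc unfolding constant_on_def by auto
    then obtain a where "a \<ge> 0" "\<phi> a \<noteq> \<phi> 0" by blast
    moreover from this have "\<phi> 0 \<le> \<phi> a" by (intro mono_onD[OF mono]) auto
    ultimately show ?thesis using that[of a] by (cases "a = 0") auto
  qed
  have bound: "\<phi> 0 + (x / a) * (\<phi> a - \<phi> 0) \<le> \<phi> x" if "x \<ge> a" for x
  proof -
    have x: "x > 0" using a that by simp
    have "\<phi> ((1 - a / x) *\<^sub>R 0 + (a / x) *\<^sub>R x) \<le> (1 - a / x) * \<phi> 0 + (a / x) * \<phi> x"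
      using a that x by (intro convex_onD[OF conv]) auto
    then have "\<phi> a \<le> (1 - a / x) * \<phi> 0 + (a / x) * \<phi> x" using x by simp
    then have "x / a * \<phi> a \<le> x / a * ((1 - a / x) * \<phi> 0 + (a / x) * \<phi> x)"
      using a x by (intro mult_left_mono) auto
    also have "\<dots> = (x / a - 1) * \<phi> 0 + \<phi> x"
      using a x by (simp add: field_simps)
    finally show ?thesis by (simp add: algebra_simps)
  qed
  have "filterlim (\<lambda>x. \<phi> 0 + x * ((\<phi> a - \<phi> 0) / a)) at_top at_top"
    using a by (intro filterlim_tendsto_add_at_top[OF tendsto_const]
        filterlim_at_top_mult_tendsto_pos[OF tendsto_const _ filterlim_ident]) auto
  then show ?thesis
    by (rule filterlim_at_top_mono)
      (use bound in \<open>auto intro!: eventually_mono[OF eventually_ge_at_top[of a]]\<close>)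
qed

section \<open>Integrals and mass bounds for radial measures\<close>

lemma borel_measurable_mono_norm:
  fixes \<phi> :: "real \<Rightarrow> real"
  assumes "mono_on {0..} \<phi>"
  shows "(\<lambda>x::'a::real_normed_vector. \<phi> (norm x)) \<in> borel_measurable borel"
proof -
  \<comment> \<open>Clamping at 0 extends \<phi> from the half-line to a function monotone on all
    reals, with the same values at norms.\<close>
  have "mono (\<lambda>s. \<phi> (max 0 s))"
    by (intro monoI mono_onD[OF assms]) auto
  then have "(\<lambda>s. \<phi> (max 0 s)) \<in> borel_measurable borel"
    by (rule borel_measurable_mono)
  then have "(\<lambda>x::'a. \<phi> (max 0 (norm x))) \<in> borel_measurable borel"
    by measurable
  then show ?thesis by simp
qed

lemma nn_integral_lborel_scaleR:
  fixes f :: "'a::euclidean_space \<Rightarrow> ennreal"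
  assumes "c \<noteq> 0" "f \<in> borel_measurable borel"
  shows "(\<integral>\<^sup>+ x. f x \<partial>lborel) = ennreal (\<bar>c\<bar> ^ DIM('a)) * (\<integral>\<^sup>+ x. f (c *\<^sub>R x) \<partial>lborel)"
proof -
  have "(\<integral>\<^sup>+ x. f x \<partial>lborel) =
      (\<integral>\<^sup>+ x. f x \<partial>(density (distr lborel borel (\<lambda>x. 0 + c *\<^sub>R x)) (\<lambda>_. ennreal (\<bar>c\<bar> ^ DIM('a)))))"
    using lborel_affine[OF assms(1), of "0::'a"] by (simp add: prod_constant)
  then show ?thesis
    using assms(2) by (simp add: nn_integral_density nn_integral_distr nn_integral_cmult)
qed

lemma radial_measure_emeasure:
  assumes "mono_on {0..} \<phi>" "A \<in> sets borel"
  shows "emeasure (radial_measure \<phi>) (A :: 'a::euclidean_space set) =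
    (\<integral>\<^sup>+ x. ennreal (exp (- \<phi> (norm x))) * indicator A x \<partial>lborel)"
proof -
  note [measurable] = borel_measurable_mono_norm[OF assms(1), where 'a='a]
  show ?thesis
    unfolding radial_measure_def using assms(2) by (subst emeasure_density) auto
qed

text \<open>The constant depends on \<open>e\<close> but neither on \<open>A\<close> nor on
  \<open>s\<close>, so ln C is negligible against \<phi>(s) once \<phi> tends to infinity.\<close>

lemma radial_measure_upper:
  fixes \<phi> :: "real \<Rightarrow> real"
  assumes mono: "mono_on {0..} \<phi>" and conv: "convex_on {0..} \<phi>"
    and prob: "prob_space (radial_measure \<phi> :: 'a::euclidean_space measure)"
    and e: "0 < e" "e < 1"
  obtains C where "C > 0"
    "\<And>(A::'a set) s. A \<in> sets borel \<Longrightarrow> s \<ge> 0 \<Longrightarrow> A \<inter> cball 0 s = {} \<Longrightarrow>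
       measure (radial_measure \<phi>) A \<le> C * exp (- (1 - e) * \<phi> s)"
proof -
  interpret prob_space "radial_measure \<phi> :: 'a measure" by (rule prob)
  note [measurable] = borel_measurable_mono_norm[OF mono, where 'a='a]
  have "emeasure (radial_measure \<phi>) (UNIV :: 'a set) = 1"
    using emeasure_space_1 by (simp add: radial_measure_def)
  then have one: "(\<integral>\<^sup>+ x. ennreal (exp (- \<phi> (norm (x::'a)))) \<partial>lborel) = 1"
    by (simp add: radial_measure_emeasure[OF mono])
  define B where "B = (\<integral>\<^sup>+ x. ennreal (exp (- \<phi> (norm (e *\<^sub>R (x::'a))))) \<partial>lborel)"
  \<comment> \<open>Substituting e x for x in the total mass 1 expresses it through
    \<open>B\<close>, which rules out an infinite \<open>B\<close>.\<close>
  have "1 = ennreal (e ^ DIM('a)) * B"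
    using nn_integral_lborel_scaleR[of e "\<lambda>x::'a. ennreal (exp (- \<phi> (norm x)))"] e one
    by (simp add: B_def)
  then have "B \<noteq> \<infinity>"
    using e by (auto simp: ennreal_mult_top)
  then obtain b where b: "b \<ge> 0" "B = ennreal b"
    by (cases B) auto
  \<comment> \<open>The summand 1 makes \<open>C\<close> positive from b \<ge> 0 alone.\<close>
  define C where "C = exp ((1 - e) * \<phi> 0) * b + 1"
  have C: "C > 0" using b by (simp add: C_def add_nonneg_pos)
  have "measure (radial_measure \<phi>) A \<le> C * exp (- (1 - e) * \<phi> s)"
    if A: "A \<in> sets borel" "s \<ge> 0" "A \<inter> cball 0 s = {}" for A :: "'a set" and s
  proof -
    let ?D = "exp (- (1 - e) * \<phi> s) * exp ((1 - e) * \<phi> 0)"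
    have le: "exp (- \<phi> (norm x)) \<le> ?D * exp (- \<phi> (norm (e *\<^sub>R x)))" if "x \<in> A" for x
    proof -
      have "s < norm x" using A that by force
      then have "\<phi> s \<le> \<phi> (norm x)" using A by (intro mono_onD[OF mono]) auto
      then have "(1 - e) * \<phi> s \<le> (1 - e) * \<phi> (norm x)" using e by (intro mult_left_mono) auto
      moreover have "\<phi> ((1 - e) *\<^sub>R 0 + e *\<^sub>R norm x) \<le> (1 - e) * \<phi> 0 + e * \<phi> (norm x)"
        using e by (intro convex_onD[OF conv]) auto
      ultimately have "- \<phi> (norm x) \<le> - (1 - e) * \<phi> s + (1 - e) * \<phi> 0 + - \<phi> (norm (e *\<^sub>R x))"
        using e by (simp add: algebra_simps)
      then show ?thesis by (simp flip: exp_add)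
    qed
    have "emeasure (radial_measure \<phi>) A =
        (\<integral>\<^sup>+ x. ennreal (exp (- \<phi> (norm x))) * indicator A x \<partial>lborel)"
      by (rule radial_measure_emeasure[OF mono A(1)])
    also have "\<dots> \<le> (\<integral>\<^sup>+ x. ennreal ?D * ennreal (exp (- \<phi> (norm (e *\<^sub>R (x::'a))))) \<partial>lborel)"
      by (rule nn_integral_mono)
        (use le in \<open>auto simp: indicator_def ennreal_mult'[symmetric] intro!: ennreal_leI\<close>)
    also have "\<dots> = ennreal ?D * B"
      unfolding B_def by (rule nn_integral_cmult) measurable
    also have "\<dots> = ennreal (?D * b)" using b by (simp add: ennreal_mult)
    finally have "measure (radial_measure \<phi>) A \<le> ?D * b"
      using b by (simp add: emeasure_eq_measure)
    also have "\<dots> \<le> C * exp (- (1 - e) * \<phi> s)"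
      by (simp add: C_def algebra_simps)
    finally show ?thesis .
  qed
  with C that show thesis by blast
qed

text \<open>Since \<phi> is increasing, the density is at least exp (- \<phi>(R)) on the small ball,
  so its mass is at least this value times its volume.\<close>

lemma radial_measure_lower:
  fixes A :: "'a::euclidean_space set"
  assumes mono: "mono_on {0..} \<phi>"
    and prob: "prob_space (radial_measure \<phi> :: 'a measure)"
    and A: "A \<in> sets borel" and ball: "ball z \<rho> \<subseteq> A" "ball z \<rho> \<subseteq> cball 0 R"
    and \<rho>: "\<rho> \<ge> 0"
  shows "measure (radial_measure \<phi>) A \<ge> unit_ball_vol (DIM('a)) * \<rho> ^ DIM('a) * exp (- \<phi> R)"
proof -
  interpret prob_space "radial_measure \<phi> :: 'a measure" by (rule prob)
  have "ennreal (exp (- \<phi> R) * (unit_ball_vol (DIM('a)) * \<rho> ^ DIM('a))) =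
      ennreal (exp (- \<phi> R)) * emeasure lborel (ball z \<rho>)"
    using \<rho> by (simp add: emeasure_ball ennreal_mult)
  also have "\<dots> = (\<integral>\<^sup>+ x. ennreal (exp (- \<phi> R)) * indicator (ball z \<rho>) x \<partial>lborel)"
    by (simp add: nn_integral_cmult_indicator)
  also have "\<dots> \<le> (\<integral>\<^sup>+ x. ennreal (exp (- \<phi> (norm x))) * indicator A x \<partial>lborel)"
  proof (rule nn_integral_mono)
    fix x :: 'a
    show "ennreal (exp (- \<phi> R)) * indicator (ball z \<rho>) x \<le>
        ennreal (exp (- \<phi> (norm x))) * indicator A x"
    proof (cases "x \<in> ball z \<rho>")
      case True
      then have "x \<in> A" "x \<in> cball 0 R" using ball by blast+
      then have "\<phi> (norm x) \<le> \<phi> R"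
        by (intro mono_onD[OF mono]) (auto intro: order_trans[OF norm_ge_zero])
      then show ?thesis using True \<open>x \<in> A\<close> by (auto intro!: ennreal_leI)
    qed auto
  qed
  also have "\<dots> = emeasure (radial_measure \<phi>) A"
    by (rule radial_measure_emeasure[OF mono A, symmetric])
  finally show ?thesis by (simp add: emeasure_eq_measure mult_ac)
qed

section \<open>Geometry of the inradius\<close>

text \<open>The maximal ball touches the boundary of \<open>K\<close> at some point
  \<open>p\<close>. A supporting hyperplane of \<open>K\<close> at \<open>p\<close> has the required
  normal: the functional is largest over \<open>K\<close> at \<open>p\<close>, where Cauchy-Schwarz
  bounds it by the inradius.\<close>

lemma inradius_supporting_halfspace:
  fixes K :: "'a::euclidean_space set"
  assumes "convex_body K" "symmetric_set K"
  obtains u where "norm u = 1" "\<And>y. y \<in> K \<Longrightarrow> y \<bullet> u \<le> relative_inradius K (cball 0 1)"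
proof -
  define r where "r = relative_inradius K (cball 0 1)"
  note max = relative_inradius_max[OF assms, folded r_def]
  have cb: "cball 0 r \<subseteq> K" using max(1,2) by (simp add: scaleR_unit_cball)
  \<comment> \<open>Otherwise compactness of the ball gives a margin \<open>e\<close> around it
    inside \<open>K\<close>, contradicting maximality of \<open>r\<close>.\<close>
  have "\<not> cball 0 r \<subseteq> interior K"
  proof
    assume "cball 0 r \<subseteq> interior K"
    then obtain e where e: "e > 0" "(\<Union>x\<in>cball 0 r. cball x e) \<subseteq> interior K"
      using compact_subset_open_imp_cball_epsilon_subset[OF compact_cball open_interior] by blast
    have "cball 0 (r + e) \<subseteq> K"
    proof
      fix z :: 'a assume z: "z \<in> cball 0 (r + e)"
      show "z \<in> K"
      proof (cases "norm z \<le> r")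
        case True
        then show ?thesis using cb by auto
      next
        case False
        then have n: "norm z > r" "norm z > 0" using max(1) by auto
        \<comment> \<open>The radial projection of \<open>z\<close> onto the sphere of radius
          \<open>r\<close>, at distance at most \<open>e\<close> from \<open>z\<close>.\<close>
        define w where "w = (r / norm z) *\<^sub>R z"
        have "norm w = r" using n max(1) by (simp add: w_def)
        have "z - w = (1 - r / norm z) *\<^sub>R z" by (simp add: w_def algebra_simps)
        then have "norm (z - w) = \<bar>1 - r / norm z\<bar> * norm z" by simp
        also have "\<dots> = norm z - r" using n max(1) by (simp add: abs_if field_simps)
        finally have "dist w z \<le> e" using z by (simp add: dist_norm norm_minus_commute)
        then have "z \<in> interior K" using e(2) \<open>norm w = r\<close> by fastforce
        then show ?thesis using interior_subset by blast
      qed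
    qed
    then have "r + e \<le> r" using max(1) e(1) by (intro max(3)) (simp_all add: scaleR_unit_cball)
    then show False using e(1) by simp
  qed
  then obtain p where "p \<in> cball 0 r" "p \<notin> interior K" by blast
  then have p: "norm p \<le> r" "p \<notin> interior K" by simp_all
  then have "p \<in> closure K" using cb closure_subset by fastforce
  moreover have "p \<notin> rel_interior K"
    using p assms by (simp add: convex_body_def rel_interior_nonempty_interior)
  moreover have "convex K" using assms by (simp add: convex_body_def)
  ultimately obtain a where a: "a \<noteq> 0" "\<And>y. y \<in> closure K \<Longrightarrow> a \<bullet> p \<le> a \<bullet> y"
    using supporting_hyperplane_rel_boundary[of "closure K" p] by (metis convex_closure convex_rel_interior_closure)
  \<comment> \<open>\<open>a\<close> is minimised over \<open>K\<close> at \<open>p\<close>, hence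
    the sign change for the outward normal.\<close>
  define u where "u = - (a /\<^sub>R norm a)"
  have u: "norm u = 1" using a by (simp add: u_def)
  have "y \<bullet> u \<le> r" if "y \<in> K" for y
  proof -
    have "a \<bullet> p \<le> a \<bullet> y" using a(2) that closure_subset by blast
    then have "y \<bullet> u \<le> p \<bullet> u"
      using a(1) by (simp add: u_def inner_commute field_simps)
    also have "\<dots> \<le> norm p * norm u" by (rule norm_cauchy_schwarz)
    also have "\<dots> \<le> r" using p u by simp
    finally show ?thesis .
  qed
  with u that show thesis by (simp add: r_def)
qed

section \<open>Growth obstruction and the limit superior\<close>

lemma no_uniform_superlinear_growth:
  fixes \<phi> :: "real \<Rightarrow> real"
  assumes mono: "mono_on {0..} \<phi>" and lim: "filterlim \<phi> at_top at_top"
    and e: "e > 0" and c: "c > 0"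
  shows "\<exists>s\<ge>S. \<exists>d>0. \<phi> (s + d) < (1 + e) * \<phi> s + ln (c * d ^ n)"
proof (rule ccontr)
  assume "\<not> ?thesis"
  then have step: "\<phi> (s + d) \<ge> (1 + e) * \<phi> s + ln (c * d ^ n)" if "s \<ge> S" "d > 0" for s d
    using that by force
  \<comment> \<open>\<open>A\<close> and \<open>B\<close> are tuned to the induction: if \<phi>(s k)
    \<ge> A + B k, the step of length (1/2)^k adds at least e (A + B k) + ln c - k n ln 2 = B + k
    \<ge> B.\<close>
  define B where "B = (real n * ln 2 + 1) / e"
  define A where "A = (B - ln c) / e"
  have B: "B > 0" using e by (simp add: B_def add_nonneg_pos)
  have "eventually (\<lambda>s. \<phi> s \<ge> A \<and> s \<ge> S \<and> s \<ge> 0) at_top"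
    using lim unfolding filterlim_at_top
    by (intro eventually_conj eventually_ge_at_top) auto
  then obtain s0 where s0: "\<phi> s0 \<ge> A" "s0 \<ge> S" "s0 \<ge> 0"
    by (auto dest!: eventually_happens)
  \<comment> \<open>The step lengths sum to 2, so all points stay in [s0, s0 + 2], while halving
    costs only a term linear in \<open>k\<close> in the logarithm.\<close>
  define s where "s k = s0 + 2 - 2 * (1/2) ^ k" for k :: nat
  have s: "s0 \<le> s k" "s k \<le> s0 + 2" for k
    by (auto simp: s_def power_le_one)
  have s_Suc: "s (Suc k) = s k + (1/2) ^ k" for k by (simp add: s_def)
  have lower: "\<phi> (s k) \<ge> A + B * real k" for k
  proof (induction k)
    case 0
    then show ?case using s0 by (simp add: s_def)
  next
    case (Suc k)
    have "ln (c * ((1/2) ^ k) ^ n) = ln c - real k * real n * ln 2"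
      using c by (simp add: ln_mult ln_realpow ln_div)
    moreover have "\<phi> (s (Suc k)) \<ge> (1 + e) * \<phi> (s k) + ln (c * ((1/2) ^ k) ^ n)"
      unfolding s_Suc using s(1)[of k] s0 by (intro step) auto
    moreover have "(1 + e) * \<phi> (s k) \<ge> (1 + e) * (A + B * real k)"
      using Suc e by (intro mult_left_mono) auto
    moreover have "(1 + e) * (A + B * real k) = A + B * real k + e * A + e * B * real k"
      by (simp add: algebra_simps)
    moreover have "e * A = B - ln c" using e by (simp add: A_def)
    moreover have "e * B = real n * ln 2 + 1" using e by (simp add: B_def)
    then have "e * B * real k = real k * real n * ln 2 + real k"
      by (simp add: algebra_simps)
    ultimately show ?case by (simp add: algebra_simps)
  qed
  obtain k :: nat where "(\<phi> (s0 + 2) - A) / B < real k" using reals_Archimedean2 by blast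
  then have "\<phi> (s0 + 2) < A + B * real k" using B by (simp add: field_simps)
  also have "\<dots> \<le> \<phi> (s k)" by (rule lower)
  also have "\<dots> \<le> \<phi> (s0 + 2)"
    using s[of k] s0 by (intro mono_onD[OF mono]) auto
  finally show False by simp
qed

theorem lemma2:
  fixes \<phi> :: "real \<Rightarrow> real" and K :: "(real ^ 'n) set"
  assumes "\<forall>s\<ge>0. \<phi> s \<ge> 0"
    and "mono_on {0..} \<phi>"
    and "convex_on {0..} \<phi>"
    and "\<not> \<phi> constant_on {0..}"
    and "prob_space (radial_measure \<phi> :: (real ^ 'n) measure)"
    and "convex_body K"
    and "symmetric_set K"
  shows "Limsup at_top (\<lambda>t::real. ereal (ln (measure (radial_measure \<phi>) (- ((*\<^sub>R) t ` K)))
           / \<phi> (relative_inradius K (cball 0 1) * t))) = -1"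
proof -
  let ?n = "DIM(real ^ 'n)"
  define r where "r = relative_inradius K (cball 0 1)"
  define m where "m t = measure (radial_measure \<phi>) (- ((*\<^sub>R) t ` K))" for t
  note mono = assms(2) and prob = assms(5)
  have lim: "filterlim \<phi> at_top at_top"
    using assms by (intro convex_mono_at_top)
  have r: "r > 0" and cb: "cball 0 r \<subseteq> K"
    using relative_inradius_max(1,2)[OF assms(6,7)] by (simp_all add: r_def scaleR_unit_cball)
  have meas: "- ((*\<^sub>R) t ` K) \<in> sets borel" for t
    using compact_scaling[of K t] assms(6)
    by (auto simp: convex_body_def intro!: borel_open compact_imp_closed)
  obtain u where u: "norm u = 1" "\<And>y. y \<in> K \<Longrightarrow> y \<bullet> u \<le> r"
    using inradius_supporting_halfspace[OF assms(6,7)] unfolding r_def by blast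
  define c where "c = unit_ball_vol (real ?n) * (1/2) ^ ?n"
  have c: "c > 0" by (simp add: c_def)
  have lower: "m t \<ge> c * d ^ ?n * exp (- \<phi> (r * t + d))" if "t > 0" "d > 0" for t d
  proof -
    \<comment> \<open>The open ball of radius d/2 about this centre touches the hyperplane x
      \<bullet> u = r t from outside, so it misses t K.\<close>
    let ?z = "(r * t + d / 2) *\<^sub>R u"
    have "ball ?z (d/2) \<subseteq> - ((*\<^sub>R) t ` K)"
    proof
      fix x assume x: "x \<in> ball ?z (d/2)"
      have "(?z - x) \<bullet> u \<le> norm (?z - x) * norm u" by (rule norm_cauchy_schwarz)
      also have "\<dots> < d / 2" using x u by (simp add: dist_norm)
      finally have gt: "x \<bullet> u > r * t"
        using u by (simp add: inner_diff_left dot_square_norm)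
      show "x \<in> - ((*\<^sub>R) t ` K)"
      proof
        assume "x \<in> (*\<^sub>R) t ` K"
        then obtain y where "y \<in> K" "x = t *\<^sub>R y" by blast
        then have "x \<bullet> u \<le> r * t"
          using u(2)[of y] that by (simp add: mult.commute)
        with gt show False by simp
      qed
    qed
    moreover have "ball ?z (d/2) \<subseteq> cball 0 (r * t + d)"
    proof
      fix x assume x: "x \<in> ball ?z (d/2)"
      have "norm x \<le> norm ?z + norm (x - ?z)" by (metis norm_triangle_sub)
      also have "norm ?z = r * t + d / 2" using u that r by (simp add: abs_of_pos add_pos_pos)
      finally show "x \<in> cball 0 (r * t + d)" using x by (simp add: dist_norm norm_minus_commute)
    qed
    ultimately show ?thesis
      using radial_measure_lower[OF mono prob meas[of t], of ?z "d/2" "r * t + d"] that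
      by (simp add: m_def c_def power_divide)
  qed
  \<comment> \<open>\<open>ln\<close> takes a default value at 0, so inequalities pass to logarithms
    only after positivity is known.\<close>
  have mpos: "m t > 0" if "t > 0" for t
    using lower[OF that, of 1] c by (auto elim!: less_le_trans[rotated])
  have filt: "filterlim (\<lambda>t. r * t) at_top at_top"
    using r by (intro filterlim_tendsto_pos_mult_at_top[OF tendsto_const _ filterlim_ident])
  then have lim': "filterlim (\<lambda>t. \<phi> (r * t)) at_top at_top"
    by (rule filterlim_compose[OF lim])
  have up: "eventually (\<lambda>t. ln (m t) / \<phi> (r * t) < y) at_top" if "y > -1" for y :: real
  proof -
    \<comment> \<open>The slack y + 1 is spent twice: one \<open>e\<close> is lost in the exponent
      of the upper bound, the other absorbs ln C.\<close>
    define e where "e = min ((y + 1) / 2) (1 / 2)"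
    have e: "0 < e" "e < 1" "2 * e \<le> y + 1" using that by (auto simp: e_def min_def field_simps)
    obtain C where C: "C > 0"
      "\<And>(A::(real^'n) set) s. A \<in> sets borel \<Longrightarrow> s \<ge> 0 \<Longrightarrow> A \<inter> cball 0 s = {} \<Longrightarrow>
       measure (radial_measure \<phi>) A \<le> C * exp (- (1 - e) * \<phi> s)"
      using radial_measure_upper[OF mono assms(3) prob e(1,2)] by blast
    have "eventually (\<lambda>t. \<phi> (r * t) > max 0 (ln C / e)) at_top"
      using lim' by (simp only: filterlim_at_top_dense)
    then show ?thesis using eventually_gt_at_top[of 0]
    proof eventually_elim
      case (elim t)
      have "- ((*\<^sub>R) t ` K) \<inter> cball 0 (r * t) = {}"
      proof -
        have "(*\<^sub>R) t ` cball 0 r = (cball 0 (r * t) :: (real^'n) set)"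
          using cball_scale[of t "0 :: real^'n" r] elim by (simp add: mult.commute)
        then show ?thesis using image_mono[OF cb, of "(*\<^sub>R) t"] by blast
      qed
      then have "m t \<le> C * exp (- (1 - e) * \<phi> (r * t))"
        unfolding m_def using r elim by (intro C(2) meas) auto
      then have "ln (m t) \<le> ln (C * exp (- (1 - e) * \<phi> (r * t)))"
        using mpos elim C by (subst ln_le_cancel_iff) auto
      also have "\<dots> = ln C - (1 - e) * \<phi> (r * t)"
        using C by (simp add: ln_mult algebra_simps)
      also have "\<dots> < e * \<phi> (r * t) - (1 - e) * \<phi> (r * t)"
        using elim e by (simp add: field_simps)
      also have "\<dots> = (2 * e - 1) * \<phi> (r * t)" by (simp add: algebra_simps)
      also have "\<dots> \<le> y * \<phi> (r * t)" using e elim by (intro mult_right_mono) auto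
      finally show ?case using elim by (simp add: field_simps)
    qed
  qed
  \<comment> \<open>Arbitrarily large \<open>t\<close> suffice for a limit superior, which matches
    the growth obstruction: it yields some \<open>s\<close> beyond each threshold.\<close>
  have low: "frequently (\<lambda>t. y < ln (m t) / \<phi> (r * t)) at_top" if "y < -1" for y :: real
  proof (rule ccontr)
    assume "\<not> ?thesis"
    then have "eventually (\<lambda>t. ln (m t) / \<phi> (r * t) \<le> y) at_top"
      by (simp add: frequently_def not_less)
    moreover have "eventually (\<lambda>t. \<phi> (r * t) > 0) at_top"
      using lim' by (simp only: filterlim_at_top_dense)
    ultimately have "eventually (\<lambda>t. ln (m t) / \<phi> (r * t) \<le> y \<and> \<phi> (r * t) > 0 \<and> t > 0) at_top"
      by (intro eventually_conj eventually_gt_at_top)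
    then obtain T where T: "\<And>t. t \<ge> T \<Longrightarrow> ln (m t) / \<phi> (r * t) \<le> y \<and> \<phi> (r * t) > 0 \<and> t > 0"
      unfolding eventually_at_top_linorder by blast
    \<comment> \<open>With - y - 1 > 0 as growth excess the factor is - y, so the logarithm of the
      lower mass bound exceeds y \<phi>(s).\<close>
    obtain s d where sd: "s \<ge> r * T" "d > 0" "\<phi> (s + d) < (1 + (- y - 1)) * \<phi> s + ln (c * d ^ ?n)"
      using no_uniform_superlinear_growth[OF mono lim _ c, of "- y - 1" "r * T" ?n] \<open>y < -1\<close> by auto
    define t where "t = s / r"
    have t: "s = r * t" "t \<ge> T" using r sd by (auto simp: t_def field_simps)
    have "ln (c * d ^ ?n) - \<phi> (s + d) = ln (c * d ^ ?n * exp (- \<phi> (s + d)))"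
      using c sd by (subst ln_mult) auto
    also have "\<dots> \<le> ln (m t)"
      using lower[of t d] mpos[of t] T[OF t(2)] t c sd by (subst ln_le_cancel_iff) auto
    also have "\<dots> \<le> y * \<phi> s" using T[OF t(2)] t(1) by (auto simp: pos_divide_le_eq)
    finally show False using sd by simp
  qed
  have "Limsup at_top (\<lambda>t. ereal (ln (m t) / \<phi> (r * t))) = -1"
  proof (rule antisym)
    show "Limsup at_top (\<lambda>t. ereal (ln (m t) / \<phi> (r * t))) \<le> -1"
      unfolding Limsup_le_iff
    proof (intro allI impI)
      fix y :: ereal assume "-1 < y"
      \<comment> \<open>\<open>y\<close> may be infinite, whereas \<open>up\<close> speaks of real
        bounds.\<close>
      then obtain z where z: "-1 < ereal z" "ereal z < y" using ereal_dense2 by blast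
      then have "eventually (\<lambda>t. ln (m t) / \<phi> (r * t) < z) at_top"
        by (intro up) (simp add: one_ereal_def)
      then show "eventually (\<lambda>t. ereal (ln (m t) / \<phi> (r * t)) < y) at_top"
        by eventually_elim (use z in \<open>auto intro: less_trans[of _ "ereal z"]\<close>)
    qed
    show "-1 \<le> Limsup at_top (\<lambda>t. ereal (ln (m t) / \<phi> (r * t)))"
    proof (rule ccontr)
      assume "\<not> ?thesis"
      then have "Limsup at_top (\<lambda>t. ereal (ln (m t) / \<phi> (r * t))) < -1"
        by (rule not_le_imp_less)
      from ereal_dense2[OF this] obtain z
        where z: "Limsup at_top (\<lambda>t. ereal (ln (m t) / \<phi> (r * t))) < ereal z" "ereal z < -1"
        by blast
      then have "frequently (\<lambda>t. z < ln (m t) / \<phi> (r * t)) at_top"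
        by (intro low) (simp add: one_ereal_def)
      moreover have "eventually (\<lambda>t. ereal (ln (m t) / \<phi> (r * t)) < ereal z) at_top"
        using z(1) by (rule Limsup_lessD)
      then have "eventually (\<lambda>t. \<not> z < ln (m t) / \<phi> (r * t)) at_top"
        by eventually_elim simp
      ultimately show False by (simp add: frequently_def)
    qed
  qed
  then show ?thesis by (simp add: m_def r_def)
qed

end
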